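(* Let $(X,d)\in\mathbf{UT}$ have at least two points, let $C(X)$ be the center of distances of $(X,d)$, and let $G_X$ be the diametrical graph of $(X,d)$. Then the following statements are equivalent: (i) The equality $C(X)=\{0,\operatorname{diam} X\}$ holds. (ii) $G_X$ is a complete multipartite graph such that at least one of its parts is a singleton. (iii) $G_X$ has a spanning star subgraph.
   Context: $\mathbb{R}^+=[0,+\infty)$. All metric spaces are non-empty. A metric space $(X,d)$ is ultrametric if $d(x,y)\le\max\{d(x,z),d(z,y)\}$ for all $x,y,z\in X$. The distance set is $D(X):=\{d(x,y): x,y\in X\}\subseteq\mathbb{R}^+$. The diameter is $\operatorname{diam} X:=\sup\{d(x,y):x,y\in X\}$, which may equal $+\infty$. The center of distances is $C(X):=\{t\in D(X): \forall p\in X\ \exists x\in X\ d(p,x)=t\}$. Graphs are simple, undirected, possibly infinite, with non-empty vertex set. The diametrical graph $G_X$ has vertex set $X$, and $\{u,v\}$ is an edge iff $u\neq v$ and $d(u,v)=\operatorname{diam} X$. For a cardinal $k\ge 2$, a graph $G$ is complete $k$-partite if $V(G)$ can be partitioned into $k$ non-empty disjoint parts so that no edge has both ends in the same part and any two vertices in different parts are adjacent; $G$ is complete multipartite if it is complete $k$-partite for some cardinal $k\ge2$. A tree is a connected graph without cycles. A tree $S$ is a star graph if there is $c\in V(S)$ with $E(S)=\{\{v,c\}: v\in V(S)\setminus\{c\}\}$. A subgraph $S$ of $G$ (i.e. $V(S)\subseteq V(G)$, $E(S)\subseteq E(G)$) is spanning if $V(S)=V(G)$. A labeled tree $T=T(l)$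 is a tree $T$ with a labeling $l\colon V(T)\to\mathbb{R}^+$. The labeling is non-degenerate if $\max\{l(u),l(v)\}>0$ for every edge $\{u,v\}\in E(T)$. For a non-degenerate labeling, the function $d_l$ on $V(T)\times V(T)$ given by $d_l(u,u)=0$ and $d_l(u,v)=\max_{w\in V(P_{u,v})} l(w)$ for $u\ne v$, where $P_{u,v}$ is the (unique, finite) path in $T$ joining $u$ and $v$ (including its endpoints), is an ultrametric on $V(T)$. $\mathbf{UT}$ denotes the class of all ultrametric spaces isometric (via a bijective distance-preserving map) to $(V(T),d_l)$ for some labeled tree $T(l)$ with non-degenerate labeling. *)

theory Defs
  imports "HOL-Analysis.Analysis"
begin

section \<open>Ultrametric spaces\<close>

text \<open>The library locale \<^locale>\<open>Metric_space\<close> admits an empty carrier, hence the extra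
  assumption. Distances are finite, but the diameter may be infinite, so it is taken
  in \<^typ>\<open>ereal\<close>.\<close>

locale Ultrametric_space = Metric_space +
  assumes nonempty: "M \<noteq> {}"
    and ultrametric: "\<And>x y z. \<lbrakk>x \<in> M; y \<in> M; z \<in> M\<rbrakk> \<Longrightarrow> d x y \<le> max (d x z) (d z y)"

definition distance_set :: "'a set \<Rightarrow> ('a \<Rightarrow> 'a \<Rightarrow> real) \<Rightarrow> real set" where
  "distance_set X d = {d x y | x y. x \<in> X \<and> y \<in> X}"

definition ediam :: "'a set \<Rightarrow> ('a \<Rightarrow> 'a \<Rightarrow> real) \<Rightarrow> ereal" where
  "ediam X d = (SUP t \<in> distance_set X d. ereal t)"

definition center_of_distances :: "'a set \<Rightarrow> ('a \<Rightarrow> 'a \<Rightarrow> real) \<Rightarrow> real set" where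
  "center_of_distances X d = {t \<in> distance_set X d. \<forall>p\<in>X. \<exists>x\<in>X. d p x = t}"


section \<open>Simple, possibly infinite graphs\<close>

record 'v sgraph =
  verts :: "'v set"
  edges :: "'v set set"

definition simple_graph :: "'v sgraph \<Rightarrow> bool" where
  "simple_graph G \<longleftrightarrow> verts G \<noteq> {} \<and>
     (\<forall>e\<in>edges G. \<exists>u\<in>verts G. \<exists>v\<in>verts G. u \<noteq> v \<and> e = {u, v})"

definition subgraph :: "'v sgraph \<Rightarrow> 'v sgraph \<Rightarrow> bool" where
  "subgraph S G \<longleftrightarrow> simple_graph S \<and> simple_graph G \<and>
     verts S \<subseteq> verts G \<and> edges S \<subseteq> edges G"

definition spanning_subgraph :: "'v sgraph \<Rightarrow> 'v sgraph \<Rightarrow> bool" where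
  "spanning_subgraph S G \<longleftrightarrow> subgraph S G \<and> verts S = verts G"

text \<open>A path is given by the non-empty list of its pairwise distinct vertices.\<close>

definition is_path :: "'v sgraph \<Rightarrow> 'v list \<Rightarrow> bool" where
  "is_path G p \<longleftrightarrow> p \<noteq> [] \<and> distinct p \<and> set p \<subseteq> verts G \<and>
     successively (\<lambda>u v. {u, v} \<in> edges G) p"

definition path_between :: "'v sgraph \<Rightarrow> 'v \<Rightarrow> 'v \<Rightarrow> 'v list \<Rightarrow> bool" where
  "path_between G u v p \<longleftrightarrow> is_path G p \<and> hd p = u \<and> last p = v"

definition is_cycle :: "'v sgraph \<Rightarrow> 'v list \<Rightarrow> bool" where
  "is_cycle G p \<longleftrightarrow> is_path G p \<and> length p \<ge> 3 \<and> {last p, hd p} \<in> edges G"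

definition connected_graph :: "'v sgraph \<Rightarrow> bool" where
  "connected_graph G \<longleftrightarrow> (\<forall>u\<in>verts G. \<forall>v\<in>verts G. \<exists>p. path_between G u v p)"

definition tree :: "'v sgraph \<Rightarrow> bool" where
  "tree G \<longleftrightarrow> simple_graph G \<and> connected_graph G \<and> (\<nexists>p. is_cycle G p)"

definition star_graph :: "'v sgraph \<Rightarrow> bool" where
  "star_graph S \<longleftrightarrow> tree S \<and>
     (\<exists>c\<in>verts S. edges S = {{v, c} | v. v \<in> verts S - {c}})"

text \<open>\<open>P\<close> is the set of parts; its cardinality, at least two and possibly infinite, is the
  \<open>k\<close> in ``complete \<open>k\<close>-partite''.\<close>

definition complete_multipartite_parts :: "'v sgraph \<Rightarrow> 'v set set \<Rightarrow> bool" where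
  "complete_multipartite_parts G P \<longleftrightarrow> simple_graph G \<and> partition_on (verts G) P \<and>
     (\<exists>A\<in>P. \<exists>B\<in>P. A \<noteq> B) \<and>
     (\<forall>A\<in>P. \<forall>u\<in>A. \<forall>v\<in>A. {u, v} \<notin> edges G) \<and>
     (\<forall>A\<in>P. \<forall>B\<in>P. A \<noteq> B \<longrightarrow> (\<forall>u\<in>A. \<forall>v\<in>B. {u, v} \<in> edges G))"

definition diametrical_graph :: "'a set \<Rightarrow> ('a \<Rightarrow> 'a \<Rightarrow> real) \<Rightarrow> 'a sgraph" where
  "diametrical_graph X d =
     \<lparr>verts = X,
      edges = {{u, v} | u v. u \<in> X \<and> v \<in> X \<and> u \<noteq> v \<and> ereal (d u v) = ediam X d}\<rparr>"

lemma simple_graph_diametrical_graph: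
  "X \<noteq> {} \<Longrightarrow> simple_graph (diametrical_graph X d)"
  by (auto simp: simple_graph_def diametrical_graph_def)


section \<open>Labeled trees and the class UT\<close>

definition labeled_tree :: "'v sgraph \<Rightarrow> ('v \<Rightarrow> real) \<Rightarrow> bool" where
  "labeled_tree T l \<longleftrightarrow> tree T \<and> (\<forall>v\<in>verts T. 0 \<le> l v)"

definition nondegenerate_labeling :: "'v sgraph \<Rightarrow> ('v \<Rightarrow> real) \<Rightarrow> bool" where
  "nondegenerate_labeling T l \<longleftrightarrow> (\<forall>u v. {u, v} \<in> edges T \<longrightarrow> 0 < max (l u) (l v))"

definition label_dist :: "'v sgraph \<Rightarrow> ('v \<Rightarrow> real) \<Rightarrow> 'v \<Rightarrow> 'v \<Rightarrow> real" where
  "label_dist T l u v = (if u = v then 0 else Max (l ` set (THE p. path_between T u v p)))"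

text \<open>A formula cannot quantify over the type of the tree's vertices, so that type is an
  explicit parameter. A theorem assuming \<open>in_UT TYPE('v) X d\<close> for a free type variable
  \<open>'v\<close> covers trees on arbitrary vertex types.\<close>

definition in_UT :: "'v itself \<Rightarrow> 'a set \<Rightarrow> ('a \<Rightarrow> 'a \<Rightarrow> real) \<Rightarrow> bool" where
  "in_UT _ X d \<longleftrightarrow> Ultrametric_space X d \<and>
     (\<exists>(T :: 'v sgraph) l f. labeled_tree T l \<and> nondegenerate_labeling T l \<and>
        bij_betw f X (verts T) \<and>
        (\<forall>x\<in>X. \<forall>y\<in>X. label_dist T l (f x) (f y) = d x y))"

end

theory Submission
  imports Defs
begin

text \<open>Each of the three conditions says that some point \<open>c\<close> is at distance \<open>diam X\<close> from every
  other point. Only passing from (i) to such a \<open>c\<close> needs the labeled tree: if \<open>diam X\<close> is a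
  distance, then, being a maximum of labels along a path, it is the label of some vertex. Every
  path starting at that vertex has maximal label at least \<open>diam X\<close>, so the vertex is the
  desired \<open>c\<close>.\<close>

section \<open>Paths in trees and the labels along them\<close>

lemma edge_commute: "{u, v} \<in> edges G \<longleftrightarrow> {v, u} \<in> edges G"
  by (simp add: insert_commute)

text \<open>Induction along the first path, cancelling the common start vertex. If the second
  vertices differed, the two tails, both ending in \<open>v\<close>, would still meet; going from
  \<open>u\<close> along one tail to the meeting point and back along the other would close a
  cycle.\<close>

lemma acyclic_path_unique:
  assumes acyclic: "\<nexists>p. is_cycle G p"
    and "path_between G u v p" "path_between G u v q"
  shows "p = q"
  using assms(2,3)
proof (induction p arbitrary: u q)
  case Nil
  then show ?case by (simp add: path_between_def is_path_def)
next
  case (Cons a p)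
  from Cons.prems obtain q' where q: "q = u # q'" and a: "a = u"
    by (cases q) (auto simp: path_between_def is_path_def)
  show ?case
  proof (cases "p = [] \<or> q' = []")
    \<comment> \<open>An empty tail forces \<open>u = v\<close>, and distinctness then makes the
      other tail empty too.\<close>
    case True
    then show ?thesis
      using Cons.prems q a
      by (auto simp: path_between_def is_path_def split: if_splits)
  next
    case False
    have p: "is_path G p" "last p = v" "u \<notin> set p" "{u, hd p} \<in> edges G" "u \<in> verts G"
      and q': "is_path G q'" "last q' = v" "u \<notin> set q'" "{u, hd q'} \<in> edges G"
      using Cons.prems q a False
      by (auto simp: path_between_def is_path_def successively_Cons)
    have "hd p = hd q'"
    proof (rule ccontr)
      assume neq: "hd p \<noteq> hd q'"
      have "\<exists>w\<in>set p. w \<in> set q'"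
        using False p(2) q'(2) last_in_set by metis
      \<comment> \<open>Choosing \<open>w\<close> as the first vertex of \<open>p\<close> on
        \<open>q'\<close> keeps \<open>p1\<close> disjoint from \<open>q'\<close>, which makes the
        closed walk below free of repetitions.\<close>
      then obtain p1 w p2 where p_split: "p = p1 @ w # p2" and w: "w \<in> set q'"
        and disj: "\<forall>y\<in>set p1. y \<notin> set q'"
        using split_list_first_prop[of p "\<lambda>w. w \<in> set q'"] by blast
      from w obtain q1 q2 where q_split: "q' = q1 @ w # q2"
        by (meson split_list)
      \<comment> \<open>From \<open>u\<close> along \<open>p\<close> to \<open>w\<close>, then
        backwards along \<open>q'\<close>. The last vertex is \<open>hd q'\<close>, also when
        \<open>q1\<close> is empty, so the closing edge is the first edge of the second
        path.\<close>
      let ?c = "u # p1 @ w # rev q1"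
      have "successively (\<lambda>x y. {x, y} \<in> edges G) q1"
        using q'(1) by (simp add: q_split is_path_def successively_append_iff)
      then have rev: "successively (\<lambda>x y. {x, y} \<in> edges G) (rev q1)"
        unfolding successively_rev by (subst insert_commute)
      have edge: "{w, last q1} \<in> edges G" if "q1 \<noteq> []"
        using q'(1) that edge_commute[of w]
        by (auto simp: q_split is_path_def successively_append_iff)
      have "successively (\<lambda>x y. {x, y} \<in> edges G) (w # rev q1)"
        using edge rev by (auto simp: successively_Cons hd_rev)
      moreover have "successively (\<lambda>x y. {x, y} \<in> edges G) p1"
        and "p1 \<noteq> [] \<Longrightarrow> {last p1, w} \<in> edges G"
        using p(1) by (auto simp: p_split is_path_def successively_append_iff)
      ultimately have "successively (\<lambda>x y. {x, y} \<in> edges G) (p1 @ w # rev q1)"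
        by (auto simp: successively_append_iff)
      moreover have "{u, hd (p1 @ w # rev q1)} \<in> edges G"
        using p(4) by (cases p1) (auto simp: p_split)
      ultimately have "successively (\<lambda>x y. {x, y} \<in> edges G) ?c"
        by (simp add: successively_Cons)
      moreover have "distinct ?c" and "set ?c \<subseteq> verts G"
        using p q' disj by (auto simp: p_split q_split is_path_def)
      ultimately have "is_path G ?c"
        by (simp add: is_path_def)
      \<comment> \<open>A shorter list would need both \<open>p1\<close> and \<open>q1\<close>
        empty; then \<open>w\<close> would be the head of both tails, against
        \<open>neq\<close>.\<close>
      moreover have "length ?c \<ge> 3"
        using neq by (cases p1; cases q1) (auto simp: p_split q_split)
      moreover have "{last ?c, hd ?c} \<in> edges G"
        using q'(4) edge_commute[of u] by (cases q1) (auto simp: q_split last_rev)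
      ultimately show False
        using acyclic unfolding is_cycle_def by blast
    qed
    then have "p = q'"
      using Cons.IH[of "hd p" q'] p q' by (simp add: path_between_def)
    then show ?thesis
      using a q by simp
  qed
qed

text \<open>Justifies the definite description in \<open>label_dist\<close>: connectedness gives
  existence, acyclicity uniqueness.\<close>

lemma tree_path_THE:
  assumes "tree T" "u \<in> verts T" "v \<in> verts T"
  shows "path_between T u v (THE p. path_between T u v p)"
proof -
  obtain p where "path_between T u v p"
    using assms unfolding tree_def connected_graph_def by blast
  moreover from this have "\<And>q. path_between T u v q \<Longrightarrow> q = p"
    using assms(1) acyclic_path_unique by (auto simp: tree_def)
  ultimately show ?thesis
    by (rule theI)
qed

lemma label_le_label_dist:
  assumes "tree T" "u \<in> verts T" "v \<in> verts T" "u \<noteq> v"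
  shows "l u \<le> label_dist T l u v"
proof -
  have "u \<in> set (THE p. path_between T u v p)"
    using tree_path_THE[OF assms(1-3)] hd_in_set
    by (fastforce simp: path_between_def is_path_def)
  then show ?thesis
    using assms(4) by (simp add: label_dist_def)
qed

text \<open>The maximum of finitely many labels is one of them. On the diagonal
  \<open>label_dist\<close> takes the value 0 by convention, which need not be a label.\<close>

lemma label_dist_attained:
  assumes "tree T" "u \<in> verts T" "v \<in> verts T" "u \<noteq> v"
  shows "\<exists>w\<in>verts T. l w = label_dist T l u v"
proof -
  let ?p = "THE p. path_between T u v p"
  have p: "?p \<noteq> []" "set ?p \<subseteq> verts T"
    using tree_path_THE[OF assms(1-3)] by (auto simp: path_between_def is_path_def)
  then have "Max (l ` set ?p) \<in> l ` set ?p"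
    by (intro Max_in) auto
  then show ?thesis
    using p(2) assms(4) by (auto simp: label_dist_def)
qed

lemma star_graph_star:
  assumes "c \<in> V"
  shows "star_graph \<lparr>verts = V, edges = {{v, c} | v. v \<in> V - {c}}\<rparr>" (is "star_graph ?S")
proof -
  have "simple_graph ?S"
    using assms by (auto simp: simple_graph_def)
  moreover have "connected_graph ?S"
    unfolding connected_graph_def
  proof (intro ballI)
    fix u v assume "u \<in> verts ?S" "v \<in> verts ?S"
    then have "path_between ?S u v
        (if u = v then [u] else if u = c \<or> v = c then [u, v] else [u, c, v])"
      using assms by (auto simp: path_between_def is_path_def doubleton_eq_iff)
    then show "\<exists>p. path_between ?S u v p" ..
  qed
  moreover have "\<not> is_cycle ?S p" for p
  proof
    assume cyc: "is_cycle ?S p"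
    then obtain x y z r where p: "p = x # y # z # r"
      by (auto simp: is_cycle_def numeral_3_eq_3 Suc_le_length_iff)
    have "last p \<in> set (z # r)"
      by (simp add: p)
    moreover have "{x, y} \<in> edges ?S" "{y, z} \<in> edges ?S" "{last p, x} \<in> edges ?S"
      and dist: "distinct p"
      using cyc by (simp_all add: p is_cycle_def is_path_def)
    \<comment> \<open>Every edge contains \<open>c\<close>. The first two edges of the cycle share
      only \<open>y\<close>, so \<open>c = y\<close>, but the closing edge avoids
      \<open>y\<close>.\<close>
    then have "c \<in> {x, y}" "c \<in> {y, z}" "c \<in> {last p, x}"
      by auto
    ultimately show False
      using dist p by auto
  qed
  ultimately show ?thesis
    using assms by (auto simp: star_graph_def tree_def)
qed

section \<open>Points at distance \<open>ediam M d\<close> from all others, and the diametrical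
  graph\<close>

context Ultrametric_space
begin

lemma dist_le_ediam: "x \<in> M \<Longrightarrow> y \<in> M \<Longrightarrow> ereal (d x y) \<le> ediam M d"
  unfolding ediam_def by (rule SUP_upper) (auto simp: distance_set_def)

lemma diametrical_edge_iff:
  assumes "x \<in> M" "y \<in> M"
  shows "{x, y} \<in> edges (diametrical_graph M d) \<longleftrightarrow> x \<noteq> y \<and> ereal (d x y) = ediam M d"
  using assms commute by (auto simp: diametrical_graph_def doubleton_eq_iff)

lemma spanning_star_iff:
  "(\<exists>S. spanning_subgraph S (diametrical_graph M d) \<and> star_graph S) \<longleftrightarrow>
   (\<exists>c\<in>M. \<forall>x\<in>M - {c}. ereal (d c x) = ediam M d)" (is "?L \<longleftrightarrow> ?R")
proof
  assume ?L
  then obtain S c where S: "spanning_subgraph S (diametrical_graph M d)"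
    and c: "c \<in> verts S" "edges S = {{v, c} | v. v \<in> verts S - {c}}"
    by (auto simp: star_graph_def)
  have V: "verts S = M" and E: "edges S \<subseteq> edges (diametrical_graph M d)"
    using S by (auto simp: spanning_subgraph_def subgraph_def diametrical_graph_def)
  have "ereal (d c x) = ediam M d" if "x \<in> M - {c}" for x
  proof -
    have "{x, c} \<in> edges (diametrical_graph M d)"
      using that c V E by auto
    then show ?thesis
      using that c(1) V diametrical_edge_iff[of x c] by (simp add: commute)
  qed
  then show ?R
    using c(1) V by auto
next
  assume ?R
  then obtain c where c: "c \<in> M" "\<And>x. x \<in> M - {c} \<Longrightarrow> ereal (d c x) = ediam M d"
    by auto
  let ?S = "\<lparr>verts = M, edges = {{v, c} | v. v \<in> M - {c}}\<rparr>"
  have star: "star_graph ?S"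
    by (rule star_graph_star[OF c(1)])
  have "edges ?S \<subseteq> edges (diametrical_graph M d)"
    using c by (auto simp: diametrical_edge_iff commute)
  then have "spanning_subgraph ?S (diametrical_graph M d)"
    using star simple_graph_diametrical_graph[OF nonempty]
    by (auto simp: spanning_subgraph_def subgraph_def star_graph_def tree_def
        diametrical_graph_def)
  with star show ?L by blast
qed

text \<open>The vertex of a singleton part is adjacent to all others. Conversely, the open balls
  whose radius is the diameter form the parts, and the ball around \<open>c\<close> is
  \<open>{c}\<close>.\<close>

lemma multipartite_singleton_iff:
  assumes two: "\<exists>x\<in>M. \<exists>y\<in>M. x \<noteq> y"
  shows "(\<exists>P. complete_multipartite_parts (diametrical_graph M d) P \<and>
      (\<exists>A\<in>P. is_singleton A)) \<longleftrightarrow>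
    (\<exists>c\<in>M. \<forall>x\<in>M - {c}. ereal (d c x) = ediam M d)" (is "?L \<longleftrightarrow> ?R")
proof
  assume ?L
  then obtain P c where P: "complete_multipartite_parts (diametrical_graph M d) P"
    and c: "{c} \<in> P"
    by (auto simp: is_singleton_def)
  have part: "partition_on M P"
    using P by (simp add: complete_multipartite_parts_def diametrical_graph_def)
  have adj: "{u, v} \<in> edges (diametrical_graph M d)"
    if "A \<in> P" "B \<in> P" "A \<noteq> B" "u \<in> A" "v \<in> B" for A B u v
    using P that by (simp add: complete_multipartite_parts_def)
  have cM: "c \<in> M"
    using part c by (auto simp: partition_on_def)
  have "ereal (d c x) = ediam M d" if x: "x \<in> M - {c}" for x
  proof -
    obtain B where "B \<in> P" "x \<in> B"
      using part x by (auto simp: partition_on_def)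
    then have "{c, x} \<in> edges (diametrical_graph M d)"
      using adj[OF c, of B c x] x by auto
    then show ?thesis
      using x cM diametrical_edge_iff by simp
  qed
  then show ?R using cM by blast
next
  assume ?R
  then obtain c where c: "c \<in> M" "\<And>x. x \<in> M - {c} \<Longrightarrow> ereal (d c x) = ediam M d"
    by auto
  \<comment> \<open>A second point shows that the diameter is a positive real \<open>D\<close>; its
    class will also be a part other than \<open>{c}\<close>.\<close>
  obtain e where e: "e \<in> M" "e \<noteq> c"
    using two by auto
  define D where "D = d c e"
  have D: "ediam M d = ereal D"
    using c(2)[of e] e by (simp add: D_def)
  have D_pos: "0 < D"
    using c(1) e by (simp add: D_def)
  have le: "d x y \<le> D" if "x \<in> M" "y \<in> M" for x y
    using dist_le_ediam[OF that] by (simp add: D)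
  \<comment> \<open>Transitivity is the ultrametric inequality; reflexivity is
    \<open>0 < D\<close>.\<close>
  define r where "r = {(x, y). x \<in> M \<and> y \<in> M \<and> d x y < D}"
  have equiv: "equiv M r"
  proof (rule equivI)
    show "r \<subseteq> M \<times> M" by (auto simp: r_def)
    show "refl_on M r" using D_pos by (auto simp: refl_on_def r_def)
    show "sym r" by (auto simp: sym_def r_def commute)
    show "trans r"
    proof (rule transI)
      fix x y z assume "(x, y) \<in> r" "(y, z) \<in> r"
      then show "(x, z) \<in> r"
        using ultrametric[of x z y] by (auto simp: r_def)
    qed
  qed
  let ?G = "diametrical_graph M d"
  have verts: "verts ?G = M"
    by (simp add: diametrical_graph_def)
  \<comment> \<open>No distance exceeds \<open>D\<close>, so a pair outside \<open>r\<close> is at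
    distance exactly \<open>D\<close>; its points differ because \<open>D\<close> is
    positive.\<close>
  have edge: "{x, y} \<in> edges ?G \<longleftrightarrow> (x, y) \<notin> r" if "x \<in> M" "y \<in> M" for x y
    using that le[OF that] D_pos
    by (auto simp: diametrical_edge_iff r_def D)
  have part: "partition_on M (M // r)"
    by (rule partition_on_quotient[OF equiv])
  have single: "r `` {c} = {c}"
  proof -
    have "x = c" if "x \<in> M" "d c x < D" for x
      using c(2)[of x] that by (auto simp: D)
    then show ?thesis
      using c(1) D_pos by (auto simp: r_def)
  qed
  have cP: "{c} \<in> M // r"
    using quotientI[OF c(1), of r] single by simp
  have eP: "r `` {e} \<in> M // r"
    using e(1) by (rule quotientI)
  have "e \<in> r `` {e}"
    using equiv_class_self[OF equiv e(1)] .
  then have "\<exists>A\<in>M // r. \<exists>B\<in>M // r. A \<noteq> B"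
    using cP eP e(2) by (metis singletonD)
  moreover have "{u, v} \<notin> edges ?G" if "A \<in> M // r" "u \<in> A" "v \<in> A" for A u v
    using that edge[of u v] quotient_eq_iff[OF equiv that(1) that(1) that(2,3)]
      in_quotient_imp_subset[OF equiv that(1)] by auto
  moreover have "{u, v} \<in> edges ?G"
    if "A \<in> M // r" "B \<in> M // r" "A \<noteq> B" "u \<in> A" "v \<in> B" for A B u v
    using that edge[of u v] quotient_eq_iff[OF equiv that(1,2,4,5)]
      in_quotient_imp_subset[OF equiv that(1)] in_quotient_imp_subset[OF equiv that(2)]
    by auto
  ultimately have "complete_multipartite_parts ?G (M // r)"
    using part simple_graph_diametrical_graph[OF nonempty, of d] verts
    unfolding complete_multipartite_parts_def by simp
  then show ?L
    using cP by (auto simp: is_singleton_def)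
qed

text \<open>Only the distances 0 and \<open>D\<close> occur from \<open>c\<close>, so nothing else
  lies in the center. Conversely \<open>D\<close> occurs from every point: from \<open>c\<close> to
  \<open>e\<close>, and from any other point to \<open>c\<close>.\<close>

lemma center_of_distances_if_dominating:
  assumes two: "\<exists>x\<in>M. \<exists>y\<in>M. x \<noteq> y"
    and c: "c \<in> M" "\<And>x. x \<in> M - {c} \<Longrightarrow> ereal (d c x) = ediam M d"
  shows "ereal ` center_of_distances M d = {0, ediam M d}"
proof -
  obtain e where e: "e \<in> M" "e \<noteq> c"
    using two by auto
  define D where "D = d c e"
  have D: "ediam M d = ereal D"
    using c(2)[of e] e by (simp add: D_def)
  have dist: "d c x = D" if "x \<in> M" "x \<noteq> c" for x
    using c(2)[of x] that by (simp add: D)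
  have "center_of_distances M d = {0, D}"
  proof (intro equalityI subsetI)
    fix t assume "t \<in> center_of_distances M d"
    then obtain x where "x \<in> M" "d c x = t"
      using c(1) by (auto simp: center_of_distances_def)
    then show "t \<in> {0, D}"
      using dist c(1) by (cases "x = c") auto
  next
    fix t assume t: "t \<in> {0, D}"
    have "\<exists>x\<in>M. d p x = t" if "p \<in> M" for p
    proof (cases "t = 0")
      case True
      then show ?thesis using that by (intro bexI[of _ p]) auto
    next
      case False
      then have "t = D"
        using t by simp
      then show ?thesis
        using that c(1) e dist by (metis commute)
    qed
    then show "t \<in> center_of_distances M d"
      using c(1) unfolding center_of_distances_def distance_set_def by blast
  qed
  then show ?thesis by (simp add: D zero_ereal_def)
qed

end

section \<open>From vertex labels to a point at maximal distance from all others\<close>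

lemma in_UT_dominating_point:
  assumes UT: "in_UT TYPE('v) X d" and two: "\<exists>x\<in>X. \<exists>y\<in>X. x \<noteq> y"
    and attained: "t \<in> distance_set X d" "ereal t = ediam X d"
  shows "\<exists>c\<in>X. \<forall>x\<in>X - {c}. ereal (d c x) = ediam X d"
proof -
  interpret Ultrametric_space X d
    using UT by (simp add: in_UT_def)
  obtain T :: "'v sgraph" and l f where T: "tree T" and f: "bij_betw f X (verts T)"
    and iso: "\<And>x y. \<lbrakk>x \<in> X; y \<in> X\<rbrakk> \<Longrightarrow> label_dist T l (f x) (f y) = d x y"
    using UT unfolding in_UT_def labeled_tree_def by blast
  have fT: "f x \<in> verts T" if "x \<in> X" for x
    using f that by (auto simp: bij_betw_def)
  have f_neq: "f x \<noteq> f y" if "x \<in> X" "y \<in> X" "x \<noteq> y" for x y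
    using f that by (auto simp: bij_betw_def inj_on_def)
  have le: "d x y \<le> t" if "x \<in> X" "y \<in> X" for x y
    using dist_le_ediam[OF that] attained(2)[symmetric] by simp
  obtain x y where xy: "x \<in> X" "y \<in> X" "d x y = t"
    using attained(1) by (auto simp: distance_set_def)
  \<comment> \<open>Distinctness guarantees that \<open>d x y\<close> is a maximum of labels and not
    the diagonal default 0. If \<open>t\<close> were 0, two different points would be farther apart
    than \<open>t\<close>.\<close>
  have "x \<noteq> y"
  proof
    assume "x = y"
    then have "t = 0" using xy by simp
    then show False
      using two le mdist_pos_less by (metis not_less)
  qed
  then obtain w where "w \<in> verts T" "l w = t"
    using label_dist_attained[OF T fT[OF xy(1)] fT[OF xy(2)] f_neq[OF xy(1,2)], of l]
      iso xy by auto
  then obtain c where c: "c \<in> X" "l (f c) = t"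
    using bij_betw_imp_surj_on[OF f] by (metis imageE)
  \<comment> \<open>The label of \<open>f c\<close> bounds \<open>d c z\<close> from below by
    \<open>t\<close>, the diameter bounds it from above.\<close>
  have "d c z = t" if "z \<in> X - {c}" for z
    using label_le_label_dist[OF T fT[of c] fT[of z] f_neq[of c z], of l] iso[of c z]
      le[of c z] c that by auto
  then show ?thesis
    using c(1) attained(2) by auto
qed

theorem theorem8:
  fixes X :: "'a set" and d :: "'a \<Rightarrow> 'a \<Rightarrow> real"
  assumes UT: "in_UT TYPE('v) X d"
    and two_points: "\<exists>x\<in>X. \<exists>y\<in>X. x \<noteq> y"
  shows "(ereal ` center_of_distances X d = {0, ediam X d} \<longleftrightarrow>
          (\<exists>P. complete_multipartite_parts (diametrical_graph X d) P \<and> (\<exists>A\<in>P. is_singleton A)))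
       \<and> ((\<exists>P. complete_multipartite_parts (diametrical_graph X d) P \<and> (\<exists>A\<in>P. is_singleton A)) \<longleftrightarrow>
          (\<exists>S. spanning_subgraph S (diametrical_graph X d) \<and> star_graph S))"
proof -
  interpret Ultrametric_space X d
    using UT by (simp add: in_UT_def)
  have "ereal ` center_of_distances X d = {0, ediam X d} \<longleftrightarrow>
      (\<exists>c\<in>X. \<forall>x\<in>X - {c}. ereal (d c x) = ediam X d)" (is "?L \<longleftrightarrow> ?R")
  proof
    assume ?L
    \<comment> \<open>Membership in the center makes the diameter finite and attained as a
      distance.\<close>
    then have "ediam X d \<in> ereal ` center_of_distances X d"
      by simp
    then obtain t where "t \<in> distance_set X d" "ereal t = ediam X d"
      by (auto simp: center_of_distances_def)
    then show ?R
      by (rule in_UT_dominating_point[OF UT two_points])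
  next
    assume ?R
    then show ?L
      using center_of_distances_if_dominating[OF two_points] by blast
  qed
  then show ?thesis
    by (simp only: multipartite_singleton_iff[OF two_points] spanning_star_iff)
qed

end
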